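(* Let $\Lambda$ be a finite simplicial graph whose vertices are labelled by groups $G_i=\langle X_i\rangle$, with each $X_i$ a finite inverse-closed generating set of $G_i$, and suppose that $\mathsf{CycGeo}(G_i,X_i)=\mathsf{ConjGeo}(G_i,X_i)$ for each $i$. If $G$ is the associated graph product of the groups $G_i$, with generating set $X=\bigcup_i X_i$, then $\mathsf{CycGeo}(G,X)=\mathsf{ConjGeo}(G,X)$.
   Context: The graph product associated with $\Lambda$ is the group generated by the vertex groups $G_i$ (i.e. the quotient of their free product) with the added relations that whenever the vertices labelled $G_i$ and $G_j$ are adjacent, the elements of $G_i$ commute with the elements of $G_j$. For a group $H=\langle Y\rangle$ with finite inverse-closed generating set $Y$: $l(w)$ is the length of a word $w\in Y^*$, $\pi:Y^*\to H$ is the natural projection, $|g|$ is the length of a shortest word over $Y$ representing $g\in H$, and $|g|_c=\min\{|h| : h \text{ conjugate to } g \text{ in } H\}$. $\mathsf{ConjGeo}(H,Y)=\{w\in Y^* : l(w)=|\pi(w)|_c\}$. A word $w$ is geodesic if $l(w)=|\pi(w)|$, and $\mathsf{CycGeo}(H,Y)$ is the set of all words $w\in Y^*$ such that every cyclic permutation of $w$ is geodesic. *)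

theory Defs
  imports "HOL-Algebra.Generated_Groups" "Graph_Theory.Pair_Digraph"
begin

section \<open>Lengths and geodesics with respect to a generating set\<close>

definition fin_inv_closed_generators :: "('a, 'b) monoid_scheme \<Rightarrow> 'a set \<Rightarrow> bool" where
  "fin_inv_closed_generators H Y \<longleftrightarrow>
     finite Y \<and> Y \<subseteq> carrier H \<and> (\<forall>y\<in>Y. inv\<^bsub>H\<^esub> y \<in> Y) \<and> generate H Y = carrier H"

definition word_value :: "('a, 'b) monoid_scheme \<Rightarrow> 'a list \<Rightarrow> 'a" where
  "word_value H w = foldr (\<otimes>\<^bsub>H\<^esub>) w \<one>\<^bsub>H\<^esub>"

definition elt_length :: "('a, 'b) monoid_scheme \<Rightarrow> 'a set \<Rightarrow> 'a \<Rightarrow> nat" where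
  "elt_length H Y g = (LEAST n. \<exists>w\<in>lists Y. word_value H w = g \<and> length w = n)"

definition conjugate :: "('a, 'b) monoid_scheme \<Rightarrow> 'a \<Rightarrow> 'a \<Rightarrow> bool" where
  "conjugate H g h \<longleftrightarrow> (\<exists>x\<in>carrier H. h = x \<otimes>\<^bsub>H\<^esub> g \<otimes>\<^bsub>H\<^esub> inv\<^bsub>H\<^esub> x)"

definition conj_length :: "('a, 'b) monoid_scheme \<Rightarrow> 'a set \<Rightarrow> 'a \<Rightarrow> nat" where
  "conj_length H Y g = (LEAST n. \<exists>h. conjugate H g h \<and> elt_length H Y h = n)"

definition geodesic :: "('a, 'b) monoid_scheme \<Rightarrow> 'a set \<Rightarrow> 'a list \<Rightarrow> bool" where
  "geodesic H Y w \<longleftrightarrow> w \<in> lists Y \<and> length w = elt_length H Y (word_value H w)"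

definition ConjGeo :: "('a, 'b) monoid_scheme \<Rightarrow> 'a set \<Rightarrow> 'a list set" where
  "ConjGeo H Y = {w \<in> lists Y. length w = conj_length H Y (word_value H w)}"

definition CycGeo :: "('a, 'b) monoid_scheme \<Rightarrow> 'a set \<Rightarrow> 'a list set" where
  "CycGeo H Y = {w \<in> lists Y. \<forall>n. geodesic H Y (rotate n w)}"


section \<open>Graph products\<close>

text \<open>
  The graph product is given by its presentation. A letter \<open>(i, g)\<close> stands for the element \<open>g\<close>
  of the vertex group at \<open>i\<close>. The first two kinds of relations below present the free product of
  the vertex groups, the third makes adjacent vertex groups commute. No letters for inverses are
  needed: \<open>(i, g)\<close> and \<open>(i, inv g)\<close> are inverse to each other modulo the first two kinds.
\<close>

definition gp_words :: "'v pair_pre_digraph \<Rightarrow> ('v \<Rightarrow> ('a, 'b) monoid_scheme) \<Rightarrow> ('v \<times> 'a) list set" where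
  "gp_words \<Lambda> G = lists (SIGMA i:pverts \<Lambda>. carrier (G i))"

inductive_set gp_rel ::
  "'v pair_pre_digraph \<Rightarrow> ('v \<Rightarrow> ('a, 'b) monoid_scheme) \<Rightarrow> (('v \<times> 'a) list \<times> ('v \<times> 'a) list) set"
  for \<Lambda> :: "'v pair_pre_digraph" and G :: "'v \<Rightarrow> ('a, 'b) monoid_scheme" where
  mult: "\<lbrakk>u \<in> gp_words \<Lambda> G; v \<in> gp_words \<Lambda> G; i \<in> pverts \<Lambda>; g \<in> carrier (G i); h \<in> carrier (G i)\<rbrakk>
     \<Longrightarrow> (u @ [(i, g), (i, h)] @ v, u @ [(i, g \<otimes>\<^bsub>G i\<^esub> h)] @ v) \<in> gp_rel \<Lambda> G"
| one: "\<lbrakk>u \<in> gp_words \<Lambda> G; v \<in> gp_words \<Lambda> G; i \<in> pverts \<Lambda>\<rbrakk>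
     \<Longrightarrow> (u @ [(i, \<one>\<^bsub>G i\<^esub>)] @ v, u @ v) \<in> gp_rel \<Lambda> G"
| comm: "\<lbrakk>u \<in> gp_words \<Lambda> G; v \<in> gp_words \<Lambda> G; (i, j) \<in> parcs \<Lambda>; g \<in> carrier (G i); h \<in> carrier (G j)\<rbrakk>
     \<Longrightarrow> (u @ [(i, g), (j, h)] @ v, u @ [(j, h), (i, g)] @ v) \<in> gp_rel \<Lambda> G"
| refl: "w \<in> gp_words \<Lambda> G \<Longrightarrow> (w, w) \<in> gp_rel \<Lambda> G"
| sym: "(w, w') \<in> gp_rel \<Lambda> G \<Longrightarrow> (w', w) \<in> gp_rel \<Lambda> G"
| trans: "\<lbrakk>(w, w') \<in> gp_rel \<Lambda> G; (w', w'') \<in> gp_rel \<Lambda> G\<rbrakk> \<Longrightarrow> (w, w'') \<in> gp_rel \<Lambda> G"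

definition graph_product ::
  "'v pair_pre_digraph \<Rightarrow> ('v \<Rightarrow> ('a, 'b) monoid_scheme) \<Rightarrow> ('v \<times> 'a) list set monoid" where
  "graph_product \<Lambda> G =
     \<lparr>carrier = gp_words \<Lambda> G // gp_rel \<Lambda> G,
      monoid.mult = (\<lambda>A B. \<Union>a\<in>A. \<Union>b\<in>B. gp_rel \<Lambda> G `` {a @ b}),
      one = gp_rel \<Lambda> G `` {[]}\<rparr>"

definition gp_incl ::
  "'v pair_pre_digraph \<Rightarrow> ('v \<Rightarrow> ('a, 'b) monoid_scheme) \<Rightarrow> 'v \<Rightarrow> 'a \<Rightarrow> ('v \<times> 'a) list set" where
  "gp_incl \<Lambda> G i g = gp_rel \<Lambda> G `` {[(i, g)]}"

text \<open>The union of the generating sets \<open>X i\<close>, taken inside the graph product.\<close>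

definition gp_generators ::
  "'v pair_pre_digraph \<Rightarrow> ('v \<Rightarrow> ('a, 'b) monoid_scheme) \<Rightarrow> ('v \<Rightarrow> 'a set) \<Rightarrow> ('v \<times> 'a) list set set" where
  "gp_generators \<Lambda> G X = (\<Union>i\<in>pverts \<Lambda>. gp_incl \<Lambda> G i ` X i)"


section \<open>The graph product is a group generated by the vertex groups\<close>

lemma gp_words_append [simp]: "u @ v \<in> gp_words \<Lambda> G \<longleftrightarrow> u \<in> gp_words \<Lambda> G \<and> v \<in> gp_words \<Lambda> G"
  by (auto simp: gp_words_def)

lemma gp_words_Nil [simp]: "[] \<in> gp_words \<Lambda> G"
  by (simp add: gp_words_def)

lemma gp_words_Cons [simp]:
  "(i, g) # w \<in> gp_words \<Lambda> G \<longleftrightarrow> i \<in> pverts \<Lambda> \<and> g \<in> carrier (G i) \<and> w \<in> gp_words \<Lambda> G"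
  by (auto simp: gp_words_def)

locale graph_of_groups = pair_graph \<Lambda> for \<Lambda> :: "'v pair_pre_digraph" +
  fixes G :: "'v \<Rightarrow> ('a, 'b) monoid_scheme"
  assumes vertex_group: "i \<in> pverts \<Lambda> \<Longrightarrow> group (G i)"
begin

lemma gp_rel_words:
  assumes "(w, w') \<in> gp_rel \<Lambda> G"
  shows "w \<in> gp_words \<Lambda> G" "w' \<in> gp_words \<Lambda> G"
proof -
  have "w \<in> gp_words \<Lambda> G \<and> w' \<in> gp_words \<Lambda> G"
    using assms
  proof induction
    case (mult u v i g h)
    then show ?case
      using monoid.m_closed[OF group.is_monoid[OF vertex_group[OF mult(3)]] mult(4,5)] by simp
  next
    case (one u v i)
    then show ?case
      using monoid.one_closed[OF group.is_monoid[OF vertex_group[OF one(3)]]] by simp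
  next
    case (comm u v i j g h)
    then show ?case
      using arc_fst_in_verts[OF comm(3)] arc_snd_in_verts[OF comm(3)] by simp
  qed simp_all
  then show "w \<in> gp_words \<Lambda> G" "w' \<in> gp_words \<Lambda> G" by auto
qed

lemma equiv_gp_rel: "equiv (gp_words \<Lambda> G) (gp_rel \<Lambda> G)"
proof (rule equivI)
  show "gp_rel \<Lambda> G \<subseteq> gp_words \<Lambda> G \<times> gp_words \<Lambda> G" by (auto dest: gp_rel_words)
  show "refl_on (gp_words \<Lambda> G) (gp_rel \<Lambda> G)"
    by (auto simp: refl_on_def intro: gp_rel.refl)
  show "sym_on UNIV (gp_rel \<Lambda> G)" by (rule symI) (rule gp_rel.sym)
  show "trans_on UNIV (gp_rel \<Lambda> G)" by (rule transI) (rule gp_rel.trans)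
qed

lemma gp_rel_context:
  assumes "(w, w') \<in> gp_rel \<Lambda> G" "p \<in> gp_words \<Lambda> G" "q \<in> gp_words \<Lambda> G"
  shows "(p @ w @ q, p @ w' @ q) \<in> gp_rel \<Lambda> G"
  using assms
proof induction
  case (mult u v i g h)
  then show ?case using gp_rel.mult[of "p @ u" \<Lambda> G "v @ q" i g h] by simp
next
  case (one u v i)
  then show ?case using gp_rel.one[of "p @ u" \<Lambda> G "v @ q" i] by simp
next
  case (comm u v i j g h)
  then show ?case using gp_rel.comm[of "p @ u" \<Lambda> G "v @ q" i j g h] by simp
next
  case (refl w)
  then show ?case by (simp add: gp_rel.refl)
qed (auto intro: gp_rel.sym gp_rel.trans)

lemma gp_rel_append:
  assumes "(u, u') \<in> gp_rel \<Lambda> G" "(v, v') \<in> gp_rel \<Lambda> G"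
  shows "(u @ v, u' @ v') \<in> gp_rel \<Lambda> G"
proof -
  have "(u @ v, u' @ v) \<in> gp_rel \<Lambda> G"
    using gp_rel_context[OF assms(1), of "[]" v] gp_rel_words[OF assms(2)] by simp
  moreover have "(u' @ v, u' @ v') \<in> gp_rel \<Lambda> G"
    using gp_rel_context[OF assms(2), of u' "[]"] gp_rel_words[OF assms(1)] by simp
  ultimately show ?thesis by (rule gp_rel.trans)
qed

lemma gp_class_eq_iff:
  assumes "u \<in> gp_words \<Lambda> G" "v \<in> gp_words \<Lambda> G"
  shows "gp_rel \<Lambda> G `` {u} = gp_rel \<Lambda> G `` {v} \<longleftrightarrow> (u, v) \<in> gp_rel \<Lambda> G"
  using eq_equiv_class_iff[OF equiv_gp_rel assms] .

lemma gp_mult_class: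
  assumes "u \<in> gp_words \<Lambda> G" "v \<in> gp_words \<Lambda> G"
  shows "gp_rel \<Lambda> G `` {u} \<otimes>\<^bsub>graph_product \<Lambda> G\<^esub> gp_rel \<Lambda> G `` {v} = gp_rel \<Lambda> G `` {u @ v}"
proof -
  have "gp_rel \<Lambda> G `` {a @ b} = gp_rel \<Lambda> G `` {u @ v}"
    if "a \<in> gp_rel \<Lambda> G `` {u}" "b \<in> gp_rel \<Lambda> G `` {v}" for a b
    using that equiv_class_eq[OF equiv_gp_rel gp_rel_append[of u a v b]] by simp
  then have "(\<Union>a\<in>gp_rel \<Lambda> G `` {u}. \<Union>b\<in>gp_rel \<Lambda> G `` {v}. gp_rel \<Lambda> G `` {a @ b}) =
      (\<Union>a\<in>gp_rel \<Lambda> G `` {u}. \<Union>b\<in>gp_rel \<Lambda> G `` {v}. gp_rel \<Lambda> G `` {u @ v})"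
    by (intro SUP_cong HOL.refl)
  also have "\<dots> = gp_rel \<Lambda> G `` {u @ v}"
    using equiv_class_self[OF equiv_gp_rel assms(1)] equiv_class_self[OF equiv_gp_rel assms(2)]
    by blast
  finally show ?thesis by (simp add: graph_product_def)
qed

lemma gp_carrier: "carrier (graph_product \<Lambda> G) = (\<lambda>w. gp_rel \<Lambda> G `` {w}) ` gp_words \<Lambda> G"
  by (auto simp: graph_product_def quotient_def)

lemma gp_one: "\<one>\<^bsub>graph_product \<Lambda> G\<^esub> = gp_rel \<Lambda> G `` {[]}"
  by (simp add: graph_product_def)

lemma monoid_graph_product: "monoid (graph_product \<Lambda> G)"
  by (rule monoidI) (auto simp: gp_carrier gp_one gp_mult_class)

lemma gp_incl_closed:
  "i \<in> pverts \<Lambda> \<Longrightarrow> g \<in> carrier (G i) \<Longrightarrow> gp_incl \<Lambda> G i g \<in> carrier (graph_product \<Lambda> G)"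
  by (auto simp: gp_incl_def gp_carrier)

lemma gp_incl_mult:
  assumes "i \<in> pverts \<Lambda>" "g \<in> carrier (G i)" "h \<in> carrier (G i)"
  shows "gp_incl \<Lambda> G i (g \<otimes>\<^bsub>G i\<^esub> h) = gp_incl \<Lambda> G i g \<otimes>\<^bsub>graph_product \<Lambda> G\<^esub> gp_incl \<Lambda> G i h"
proof -
  have "g \<otimes>\<^bsub>G i\<^esub> h \<in> carrier (G i)"
    using assms vertex_group by (simp add: group.is_monoid monoid.m_closed)
  then show ?thesis
    using assms gp_rel.mult[of "[]" \<Lambda> G "[]" i g h]
    by (auto simp: gp_incl_def gp_mult_class gp_class_eq_iff intro: gp_rel.sym)
qed

lemma gp_incl_one:
  assumes "i \<in> pverts \<Lambda>"
  shows "gp_incl \<Lambda> G i \<one>\<^bsub>G i\<^esub> = \<one>\<^bsub>graph_product \<Lambda> G\<^esub>"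
  using assms gp_rel.one[of "[]" \<Lambda> G "[]" i] vertex_group
  by (auto simp: gp_incl_def gp_one gp_class_eq_iff group.is_monoid monoid.one_closed)

lemma gp_incl_commute:
  assumes "(i, j) \<in> parcs \<Lambda>" "g \<in> carrier (G i)" "h \<in> carrier (G j)"
  shows "gp_incl \<Lambda> G i g \<otimes>\<^bsub>graph_product \<Lambda> G\<^esub> gp_incl \<Lambda> G j h =
         gp_incl \<Lambda> G j h \<otimes>\<^bsub>graph_product \<Lambda> G\<^esub> gp_incl \<Lambda> G i g"
  using assms gp_rel.comm[of "[]" \<Lambda> G "[]" i j g h]
    arc_fst_in_verts[OF assms(1)] arc_snd_in_verts[OF assms(1)]
  by (simp add: gp_incl_def gp_mult_class gp_class_eq_iff)

lemma gp_class_Cons: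
  assumes "(i, g) # w \<in> gp_words \<Lambda> G"
  shows "gp_rel \<Lambda> G `` {(i, g) # w} = gp_incl \<Lambda> G i g \<otimes>\<^bsub>graph_product \<Lambda> G\<^esub> gp_rel \<Lambda> G `` {w}"
  using assms gp_mult_class[of "[(i, g)]" w] by (simp add: gp_incl_def)

lemma gp_incl_l_inv:
  assumes "i \<in> pverts \<Lambda>" "g \<in> carrier (G i)"
  shows "gp_incl \<Lambda> G i (inv\<^bsub>G i\<^esub> g) \<otimes>\<^bsub>graph_product \<Lambda> G\<^esub> gp_incl \<Lambda> G i g = \<one>\<^bsub>graph_product \<Lambda> G\<^esub>"
  using assms vertex_group[OF assms(1)]
  by (simp add: gp_incl_mult[symmetric] group.l_inv gp_incl_one)

lemma group_graph_product: "group (graph_product \<Lambda> G)"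
proof -
  interpret P: monoid "graph_product \<Lambda> G" by (rule monoid_graph_product)
  have "\<exists>y\<in>carrier (graph_product \<Lambda> G).
          y \<otimes>\<^bsub>graph_product \<Lambda> G\<^esub> gp_rel \<Lambda> G `` {w} = \<one>\<^bsub>graph_product \<Lambda> G\<^esub>"
    if "w \<in> gp_words \<Lambda> G" for w
    using that
  proof (induction w)
    case Nil
    have "\<one>\<^bsub>graph_product \<Lambda> G\<^esub> \<otimes>\<^bsub>graph_product \<Lambda> G\<^esub> gp_rel \<Lambda> G `` {[]} = \<one>\<^bsub>graph_product \<Lambda> G\<^esub>"
      using P.l_one[OF P.one_closed] unfolding gp_one .
    then show ?case using P.one_closed by blast
  next
    case (Cons x w)
    obtain i g where x: "x = (i, g)" by (cases x)
    with Cons.prems have mem: "i \<in> pverts \<Lambda>" "g \<in> carrier (G i)" "w \<in> gp_words \<Lambda> G" by auto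
    then obtain y where y: "y \<in> carrier (graph_product \<Lambda> G)"
      "y \<otimes>\<^bsub>graph_product \<Lambda> G\<^esub> gp_rel \<Lambda> G `` {w} = \<one>\<^bsub>graph_product \<Lambda> G\<^esub>"
      using Cons.IH by auto
    let ?a = "gp_incl \<Lambda> G i g" and ?b = "gp_incl \<Lambda> G i (inv\<^bsub>G i\<^esub> g)" and ?c = "gp_rel \<Lambda> G `` {w}"
    have cl: "?a \<in> carrier (graph_product \<Lambda> G)" "?b \<in> carrier (graph_product \<Lambda> G)"
      "?c \<in> carrier (graph_product \<Lambda> G)"
      using mem vertex_group[of i] by (simp_all add: gp_incl_closed) (simp add: gp_carrier)
    have "(y \<otimes>\<^bsub>graph_product \<Lambda> G\<^esub> ?b) \<otimes>\<^bsub>graph_product \<Lambda> G\<^esub> (?a \<otimes>\<^bsub>graph_product \<Lambda> G\<^esub> ?c) =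
      y \<otimes>\<^bsub>graph_product \<Lambda> G\<^esub> ((?b \<otimes>\<^bsub>graph_product \<Lambda> G\<^esub> ?a) \<otimes>\<^bsub>graph_product \<Lambda> G\<^esub> ?c)"
      using cl y(1) P.m_assoc P.m_closed by metis
    also have "\<dots> = \<one>\<^bsub>graph_product \<Lambda> G\<^esub>"
      using y(2) P.l_one[OF cl(3)] unfolding gp_incl_l_inv[OF mem(1,2)] by simp
    finally have "(y \<otimes>\<^bsub>graph_product \<Lambda> G\<^esub> ?b) \<otimes>\<^bsub>graph_product \<Lambda> G\<^esub> gp_rel \<Lambda> G `` {x # w} = \<one>\<^bsub>graph_product \<Lambda> G\<^esub>"
      unfolding x gp_class_Cons[OF Cons.prems[unfolded x]] .
    then show ?case using P.m_closed[OF y(1) cl(2)] by blast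
  qed
  then have "\<exists>y\<in>carrier (graph_product \<Lambda> G). y \<otimes>\<^bsub>graph_product \<Lambda> G\<^esub> A = \<one>\<^bsub>graph_product \<Lambda> G\<^esub>"
    if "A \<in> carrier (graph_product \<Lambda> G)" for A
    using that unfolding gp_carrier by blast
  then show ?thesis by (rule P.group_l_invI)
qed

lemma gp_incl_hom: "i \<in> pverts \<Lambda> \<Longrightarrow> gp_incl \<Lambda> G i \<in> hom (G i) (graph_product \<Lambda> G)"
  by (intro homI gp_incl_closed gp_incl_mult)

lemma gp_generators_generate:
  assumes "\<And>i. i \<in> pverts \<Lambda> \<Longrightarrow> fin_inv_closed_generators (G i) (X i)"
  shows "fin_inv_closed_generators (graph_product \<Lambda> G) (gp_generators \<Lambda> G X)"
proof -
  let ?P = "graph_product \<Lambda> G" and ?Y = "gp_generators \<Lambda> G X"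
  interpret P: group ?P by (rule group_graph_product)
  have X: "finite (X i)" "X i \<subseteq> carrier (G i)" "\<And>x. x \<in> X i \<Longrightarrow> inv\<^bsub>G i\<^esub> x \<in> X i"
    "generate (G i) (X i) = carrier (G i)" if "i \<in> pverts \<Lambda>" for i
    using assms[OF that] by (auto simp: fin_inv_closed_generators_def)
  have hom: "group_hom (G i) ?P (gp_incl \<Lambda> G i)" if "i \<in> pverts \<Lambda>" for i
    using that vertex_group gp_incl_hom P.is_group
    by (simp add: group_hom_def group_hom_axioms_def)
  have sub: "?Y \<subseteq> carrier ?P"
    using X(2) gp_incl_closed by (fastforce simp: gp_generators_def)
  have fin: "finite ?Y"
    using X(1) pair_finite_verts by (auto simp: gp_generators_def)
  have inv: "inv\<^bsub>?P\<^esub> y \<in> ?Y" if "y \<in> ?Y" for y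
  proof -
    from that obtain i x where ix: "i \<in> pverts \<Lambda>" "x \<in> X i" "y = gp_incl \<Lambda> G i x"
      by (auto simp: gp_generators_def)
    then have "inv\<^bsub>?P\<^esub> y = gp_incl \<Lambda> G i (inv\<^bsub>G i\<^esub> x)"
      using group_hom.hom_inv[OF hom[OF ix(1)], of x] X(2) by auto
    then show ?thesis using ix(1) X(3)[OF ix(1,2)] unfolding gp_generators_def by blast
  qed
  have vertex: "gp_incl \<Lambda> G i g \<in> generate ?P ?Y" if "i \<in> pverts \<Lambda>" "g \<in> carrier (G i)" for i g
  proof -
    have "gp_incl \<Lambda> G i ` carrier (G i) = generate ?P (gp_incl \<Lambda> G i ` X i)"
      using group_hom.generate_img[OF hom[OF that(1)] X(2)[OF that(1)]] X(4)[OF that(1)] by simp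
    also have "\<dots> \<subseteq> generate ?P ?Y"
      using that(1) by (intro P.mono_generate) (auto simp: gp_generators_def)
    finally show ?thesis using that(2) by auto
  qed
  have "gp_rel \<Lambda> G `` {w} \<in> generate ?P ?Y" if "w \<in> gp_words \<Lambda> G" for w
    using that
  proof (induction w)
    case Nil
    then show ?case using generate.one[of ?P] by (simp add: gp_one)
  next
    case (Cons x w)
    obtain i g where x: "x = (i, g)" by (cases x)
    have "gp_incl \<Lambda> G i g \<in> generate ?P ?Y" "gp_rel \<Lambda> G `` {w} \<in> generate ?P ?Y"
      using Cons vertex x by simp_all
    then show ?case
      using generate.eng gp_class_Cons[OF Cons.prems[unfolded x]] x by metis
  qed
  then have "generate ?P ?Y = carrier ?P"
    using P.generate_incl[OF sub] unfolding gp_carrier by blast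
  then show ?thesis
    using fin sub inv unfolding fin_inv_closed_generators_def by blast
qed

end

end

theory Submission
  imports Defs
begin

text \<open>
  Let \<open>w\<close> be a cyclically geodesic word in the graph product, and let \<open>v\<close> be any word that represents a
  conjugate of it. We compare the number of letters from each vertex group \<open>G i\<close> separately.

  If every other letter of \<open>w\<close> belongs to a neighbour of \<open>i\<close>, then retract to \<open>G i\<close>. The \<open>i\<close>-letters of
  \<open>w\<close> form a cyclically geodesic word over \<open>X i\<close>, so the hypothesis on \<open>G i\<close> applies.

  Otherwise use a translation length. The kernel of the retraction that kills \<open>G i\<close> is a free product
  of copies of \<open>G i\<close>, indexed by the cosets of the subgroup generated by the link of \<open>i\<close>, and the
  graph product acts on the normal forms of this free product. Each \<open>i\<close>-letter raises the weight of a
  normal form by at most one. For the powers of \<open>w\<close> no cancellation happens, so \<open>w^n\<close> has weight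
  exactly \<open>n\<close> times the number of \<open>i\<close>-letters of \<open>w\<close>. As \<open>w^n\<close> is conjugate to \<open>v^n\<close> by an element
  independent of \<open>n\<close>, letting \<open>n\<close> grow shows that \<open>v\<close> has at least as many \<open>i\<close>-letters as \<open>w\<close>.
\<close>

section \<open>Rotations and periodic words\<close>

text \<open>Rotating \<open>w\<close> just past its first letter with \<open>Q\<close> rotates the
  filtered word by one step. Cyclic geodesicity can thus pass to the letters of one vertex.\<close>

lemma rotate_filter:
  "\<exists>m. rotate n (filter Q w) = filter Q (rotate m w)"
proof (induction n)
  case 0
  have "rotate 0 (filter Q w) = filter Q (rotate 0 w)" by simp
  then show ?case ..
next
  case (Suc n)
  then obtain m where m: "rotate n (filter Q w) = filter Q (rotate m w)" by blast
  define u where "u = rotate m w"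
  have "\<exists>k. rotate1 (filter Q u) = filter Q (rotate k u)"
  proof (cases "\<exists>x\<in>set u. Q x")
    case True
    then obtain a b c where u: "u = a @ b # c" and "Q b" "\<forall>x\<in>set a. \<not> Q x"
      using split_list_first_prop by metis
    then have "rotate1 (filter Q u) = filter Q (c @ (a @ [b]))" by simp
    also have "\<dots> = filter Q (rotate (length (a @ [b])) u)"
      using rotate_append[of "a @ [b]" c] u by simp
    finally show ?thesis by blast
  next
    case False
    then have "rotate1 (filter Q u) = filter Q (rotate 0 u)" by (simp add: filter_False)
    then show ?thesis by blast
  qed
  then show ?case using m u_def by (auto simp: rotate_rotate)
qed

lemma nth_concat_replicate:
  "k < n * length w \<Longrightarrow> concat (replicate n w) ! k = w ! (k mod length w)"
proof (induction n arbitrary: k)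
  case (Suc n)
  then show ?case
    by (cases "k < length w") (auto simp: nth_append le_mod_geq)
qed simp

lemma length_concat_replicate: "length (concat (replicate n w)) = n * length w"
  by (induction n) auto

text \<open>The factor reads \<open>w\<close> cyclically from position \<open>length p\<close>, and
  by its length it goes round at most once.\<close>

lemma periodic_factor_short:
  assumes "concat (replicate n w) = p @ u @ q" "length u \<le> length w"
  shows "u = take (length u) (rotate (length p) w)"
proof (rule nth_equalityI)
  show "length u = length (take (length u) (rotate (length p) w))" using assms(2) by simp
  fix k assume k: "k < length u"
  have "length p + k < n * length w"
    using k arg_cong[OF assms(1), of length] unfolding length_concat_replicate by simp
  then have "(p @ u @ q) ! (length p + k) = w ! ((length p + k) mod length w)"
    using nth_concat_replicate assms(1) by metis
  then show "u ! k = take (length u) (rotate (length p) w) ! k"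
    using k assms(2) by (simp add: nth_append nth_rotate)
qed

lemma periodic_factor_long:
  assumes "concat (replicate n w) = p @ u @ q" "length w \<le> length u"
  shows "set w \<subseteq> set u"
proof -
  have "concat (replicate n w) = p @ take (length w) u @ (drop (length w) u @ q)"
    using assms(1) by simp
  from periodic_factor_short[OF this] have "take (length w) u = rotate (length p) w"
    using assms(2) by simp
  then show ?thesis using set_take_subset[of "length w" u] by (metis set_rotate)
qed

section \<open>Word length in a group\<close>

locale finitely_generated = group H for H (structure) +
  fixes Y :: "'a set"
  assumes generators: "fin_inv_closed_generators H Y"
begin

lemma gens_closed: "Y \<subseteq> carrier H"
  using generators by (simp add: fin_inv_closed_generators_def)

lemma word_value_simps [simp]:
  "word_value H [] = \<one>" "word_value H (x # w) = x \<otimes> word_value H w"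
  by (simp_all add: word_value_def)

lemma word_value_closed [simp]: "w \<in> lists Y \<Longrightarrow> word_value H w \<in> carrier H"
  using gens_closed by (induction w) auto

lemma word_value_append:
  "u \<in> lists Y \<Longrightarrow> v \<in> lists Y \<Longrightarrow> word_value H (u @ v) = word_value H u \<otimes> word_value H v"
  using gens_closed by (induction u) (auto simp: m_assoc subset_iff)

lemma ex_word:
  assumes "g \<in> carrier H"
  shows "\<exists>w\<in>lists Y. word_value H w = g"
proof -
  have "g \<in> generate H Y" using assms generators by (simp add: fin_inv_closed_generators_def)
  then show ?thesis
  proof induction
    case one
    show ?case by (rule bexI[of _ "[]"]) auto
  next
    case (incl y)
    then show ?case using gens_closed by (intro bexI[of _ "[y]"]) auto
  next
    case (inv y)
    then have "inv y \<in> Y" using generators by (simp add: fin_inv_closed_generators_def)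
    then show ?case using gens_closed by (intro bexI[of _ "[inv y]"]) auto
  next
    case (eng g h)
    then obtain u v where "u \<in> lists Y" "v \<in> lists Y" "word_value H u = g" "word_value H v = h"
      by blast
    then show ?case by (intro bexI[of _ "u @ v"]) (auto simp: word_value_append)
  qed
qed

lemma elt_length_le: "w \<in> lists Y \<Longrightarrow> elt_length H Y (word_value H w) \<le> length w"
  unfolding elt_length_def by (rule Least_le) blast

lemma ex_geodesic:
  assumes "g \<in> carrier H"
  obtains w where "w \<in> lists Y" "word_value H w = g" "length w = elt_length H Y g"
proof -
  have "\<exists>n. \<exists>w\<in>lists Y. word_value H w = g \<and> length w = n" using ex_word[OF assms] by blast
  from LeastI_ex[OF this] show thesis using that unfolding elt_length_def by blast
qed

lemma geodesic_iff:
  "geodesic H Y w \<longleftrightarrow>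
     w \<in> lists Y \<and> (\<forall>v\<in>lists Y. word_value H v = word_value H w \<longrightarrow> length w \<le> length v)"
proof
  assume "geodesic H Y w"
  then show "w \<in> lists Y \<and> (\<forall>v\<in>lists Y. word_value H v = word_value H w \<longrightarrow> length w \<le> length v)"
    unfolding geodesic_def using elt_length_le by metis
next
  assume *: "w \<in> lists Y \<and> (\<forall>v\<in>lists Y. word_value H v = word_value H w \<longrightarrow> length w \<le> length v)"
  then obtain v where "v \<in> lists Y" "word_value H v = word_value H w"
      "length v = elt_length H Y (word_value H w)"
    using ex_geodesic word_value_closed by metis
  then show "geodesic H Y w" unfolding geodesic_def using * elt_length_le by (metis le_antisym)
qed

lemma elt_length_one [simp]: "elt_length H Y \<one> = 0"
  using elt_length_le[of "[]"] by simp

lemma elt_length_generator: "x \<in> Y \<Longrightarrow> elt_length H Y x \<le> 1"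
  using elt_length_le[of "[x]"] gens_closed by auto

lemma elt_length_mult:
  assumes "g \<in> carrier H" "h \<in> carrier H"
  shows "elt_length H Y (g \<otimes> h) \<le> elt_length H Y g + elt_length H Y h"
proof -
  obtain u v where "u \<in> lists Y" "word_value H u = g" "length u = elt_length H Y g"
      "v \<in> lists Y" "word_value H v = h" "length v = elt_length H Y h"
    using ex_geodesic assms by metis
  then show ?thesis using elt_length_le[of "u @ v"] word_value_append[of u v] by auto
qed

section \<open>Conjugacy length and rotations\<close>

lemma conjugate_refl: "g \<in> carrier H \<Longrightarrow> conjugate H g g"
  unfolding conjugate_def by (rule bexI[of _ \<one>]) auto

lemma conjugate_closed: "conjugate H g h \<Longrightarrow> g \<in> carrier H \<Longrightarrow> h \<in> carrier H"
  unfolding conjugate_def by auto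

lemma conj_length_le: "conjugate H g h \<Longrightarrow> conj_length H Y g \<le> elt_length H Y h"
  unfolding conj_length_def by (rule Least_le) blast

text \<open>Minimizing over conjugates and then over their words amounts to one comparison with all
  words that represent a conjugate.\<close>

lemma ConjGeo_iff:
  "w \<in> ConjGeo H Y \<longleftrightarrow>
     w \<in> lists Y \<and>
     (\<forall>v\<in>lists Y. conjugate H (word_value H w) (word_value H v) \<longrightarrow> length w \<le> length v)"
  (is "_ \<longleftrightarrow> ?R")
proof
  assume "w \<in> ConjGeo H Y"
  then show ?R unfolding ConjGeo_def
    using conj_length_le elt_length_le le_trans by fastforce
next
  assume R: ?R
  let ?g = "word_value H w"
  have g: "?g \<in> carrier H" using R by simp
  have "\<exists>n h. conjugate H ?g h \<and> elt_length H Y h = n" using conjugate_refl[OF g] by blast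
  from LeastI_ex[OF this] obtain h where
    h: "conjugate H ?g h" "elt_length H Y h = conj_length H Y ?g"
    unfolding conj_length_def by blast
  obtain v where "v \<in> lists Y" "word_value H v = h" "length v = elt_length H Y h"
    using ex_geodesic conjugate_closed[OF h(1) g] by metis
  then have "length w \<le> conj_length H Y ?g" using R h by metis
  moreover have "conj_length H Y ?g \<le> length w"
    using conj_length_le[OF conjugate_refl[OF g]] elt_length_le[of w] R by simp
  ultimately show "w \<in> ConjGeo H Y" using R by (simp add: ConjGeo_def)
qed

lemma conjugate_rotate:
  assumes "w \<in> lists Y"
  shows "conjugate H (word_value H w) (word_value H (rotate n w))"
proof -
  define u v where "u = take (n mod length w) w" and "v = drop (n mod length w) w"
  have w: "w = u @ v" "u \<in> lists Y" "v \<in> lists Y"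
    using assms append_in_lists_conv[of u v Y] by (auto simp: u_def v_def)
  have "rotate n w = v @ u" by (simp add: rotate_drop_take u_def v_def)
  \<comment> \<open>With \<open>w = u @ v\<close>, the rotation \<open>v @ u\<close> is the
    conjugate of \<open>w\<close> by the inverse of \<open>u\<close>.\<close>
  then have "word_value H (rotate n w) =
      inv (word_value H u) \<otimes> word_value H w \<otimes> inv (inv (word_value H u))"
    using w by (simp add: word_value_append m_assoc[symmetric])
  then show ?thesis using w unfolding conjugate_def by (metis inv_closed word_value_closed)
qed

text \<open>A rotation of \<open>w\<close> has the same length and represents a conjugate, so no
  word for it can be shorter than \<open>w\<close>.\<close>

lemma ConjGeo_subset_CycGeo: "ConjGeo H Y \<subseteq> CycGeo H Y"
proof
  fix w assume w: "w \<in> ConjGeo H Y"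
  then have lists: "w \<in> lists Y" by (simp add: ConjGeo_iff)
  have "geodesic H Y (rotate n w)" for n
  proof -
    have "rotate n w \<in> lists Y" using lists by (simp add: in_lists_conv_set)
    moreover have "length (rotate n w) \<le> length v"
      if "v \<in> lists Y" "word_value H v = word_value H (rotate n w)" for v
      using w that conjugate_rotate[OF lists, of n] by (simp add: ConjGeo_iff)
    ultimately show ?thesis by (auto simp: geodesic_iff)
  qed
  then show "w \<in> CycGeo H Y" using lists by (simp add: CycGeo_def)
qed

end

section \<open>Words over the vertex groups\<close>

lemma map_Pair_in_lists_Sigma: "i \<in> I \<Longrightarrow> v \<in> lists (X i) \<Longrightarrow> map (Pair i) v \<in> lists (Sigma I X)"
  by (auto simp: in_lists_conv_set)

locale generated_graph_product = graph_of_groups \<Lambda> G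
  for \<Lambda> :: "'v pair_pre_digraph" and G :: "'v \<Rightarrow> ('a, 'b) monoid_scheme" +
  fixes X :: "'v \<Rightarrow> 'a set"
  assumes vertex_generators: "i \<in> pverts \<Lambda> \<Longrightarrow> fin_inv_closed_generators (G i) (X i)"
begin

abbreviation "P \<equiv> graph_product \<Lambda> G"
abbreviation "R \<equiv> gp_rel \<Lambda> G"
abbreviation "cls w \<equiv> R `` {w}"
text \<open>Letters keep their vertex label, instead of being elements of \<open>P\<close>, so that
  the letters of each vertex can be counted.\<close>

abbreviation "gen_words \<equiv> lists (SIGMA i:pverts \<Lambda>. X i)"
abbreviation "link i \<equiv> {j. (i, j) \<in> parcs \<Lambda>}"
abbreviation "restrict_word S \<equiv> filter (\<lambda>x. fst x \<in> S)"

sublocale P: finitely_generated P "gp_generators \<Lambda> G X"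
  by (intro finitely_generated.intro finitely_generated_axioms.intro group_graph_product
      gp_generators_generate vertex_generators)

lemma finitely_generated_vertex:
  "i \<in> pverts \<Lambda> \<Longrightarrow> finitely_generated (G i) (X i)"
  by (intro finitely_generated.intro finitely_generated_axioms.intro vertex_group
      vertex_generators)

lemma link_verts: "j \<in> link i \<Longrightarrow> j \<in> pverts \<Lambda>"
  using arc_snd_in_verts by fastforce

lemma not_in_link [simp]: "(i, i) \<notin> parcs \<Lambda>"
  using pair_no_loops by fastforce

lemma link_sym: "(i, j) \<in> parcs \<Lambda> \<Longrightarrow> (j, i) \<in> parcs \<Lambda>"
  using pair_sym_arcs by (auto simp: symmetric_def dest: symD)

lemma gen_words_closed: "w \<in> gen_words \<Longrightarrow> w \<in> gp_words \<Lambda> G"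
  using finitely_generated.gens_closed[OF finitely_generated_vertex]
  unfolding gp_words_def in_lists_conv_set by fastforce

lemma cls_closed [simp]: "w \<in> gp_words \<Lambda> G \<Longrightarrow> cls w \<in> carrier P"
  by (auto simp: gp_carrier)

lemma gen_words_value:
  "w \<in> gen_words \<Longrightarrow> word_value P (map (case_prod (gp_incl \<Lambda> G)) w) = cls w"
proof (induction w)
  case Nil
  then show ?case by (simp add: gp_one)
next
  case (Cons x w)
  then show ?case using gen_words_closed[of "x # w"]
    by (cases x) (simp add: gp_class_Cons)
qed

lemma gen_words_image:
  "lists (gp_generators \<Lambda> G X) = map (case_prod (gp_incl \<Lambda> G)) ` gen_words"
proof -
  have "gp_generators \<Lambda> G X = case_prod (gp_incl \<Lambda> G) ` (SIGMA i:pverts \<Lambda>. X i)"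
    by (force simp: gp_generators_def)
  then show ?thesis by (simp add: lists_image)
qed

section \<open>Geodesic labelled words and retractions\<close>

definition geo_word :: "('v \<times> 'a) list \<Rightarrow> bool" where
  "geo_word w \<longleftrightarrow> w \<in> gen_words \<and> (\<forall>v\<in>gen_words. (v, w) \<in> R \<longrightarrow> length w \<le> length v)"

lemma geodesic_iff_geo_word:
  assumes "w \<in> gen_words"
  shows "geodesic P (gp_generators \<Lambda> G X) (map (case_prod (gp_incl \<Lambda> G)) w) \<longleftrightarrow> geo_word w"
  using assms unfolding P.geodesic_iff geo_word_def gen_words_image
  by (auto simp: gen_words_value gp_class_eq_iff gen_words_closed)

text \<open>A shorter word for \<open>u\<close> could be substituted into the whole word.\<close>

lemma geo_word_factor:
  assumes "geo_word (p @ u @ q)"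
  shows "geo_word u"
  unfolding geo_word_def
proof (intro conjI ballI impI)
  have mem: "p \<in> gen_words" "u \<in> gen_words" "q \<in> gen_words"
    using assms by (simp_all add: geo_word_def)
  show "u \<in> gen_words" by fact
  fix v assume v: "v \<in> gen_words" "(v, u) \<in> R"
  have "(p @ v @ q, p @ u @ q) \<in> R"
    using gp_rel_context v(2) mem gen_words_closed by blast
  then have "length (p @ u @ q) \<le> length (p @ v @ q)"
    using assms v(1) mem unfolding geo_word_def by (metis append_in_lists_conv)
  then show "length u \<le> length v" by simp
qed

lemma gp_words_filter: "w \<in> gp_words \<Lambda> G \<Longrightarrow> filter Q w \<in> gp_words \<Lambda> G"
  by (auto simp: gp_words_def in_lists_conv_set)

text \<open>Erasing the letters outside \<open>S\<close> turns each defining relation into a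
  defining relation or an equality: this is the retraction onto the subgroup generated by the vertex
  groups in \<open>S\<close>.\<close>

lemma gp_rel_restrict:
  "(v, w) \<in> R \<Longrightarrow> (restrict_word S v, restrict_word S w) \<in> R"
proof (induction rule: gp_rel.induct)
  case (mult u v i g h)
  then show ?case
    using gp_rel.mult[of "restrict_word S u" \<Lambda> G "restrict_word S v" i g h]
    by (auto simp: gp_words_filter intro: gp_rel.refl)
next
  case (one u v i)
  then show ?case
    using gp_rel.one[of "restrict_word S u" \<Lambda> G "restrict_word S v" i]
    by (auto simp: gp_words_filter intro: gp_rel.refl)
next
  case (comm u v i j g h)
  then show ?case
    using gp_rel.comm[of "restrict_word S u" \<Lambda> G "restrict_word S v" i j g h]
      arc_fst_in_verts[OF comm(3)] arc_snd_in_verts[OF comm(3)]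
    by (auto simp: gp_words_filter intro: gp_rel.refl)
next
  case (refl w)
  then show ?case by (simp add: gp_words_filter gp_rel.refl)
next
  case (sym w w')
  show ?case using sym.IH by (rule gp_rel.sym)
next
  case (trans w w' w'')
  show ?case using trans.IH by (rule gp_rel.trans)
qed

definition vertex_letters :: "'v \<Rightarrow> ('v \<times> 'a) list \<Rightarrow> 'a list" where
  "vertex_letters i w = map snd (filter (\<lambda>x. fst x = i) w)"

lemma vertex_letters_simps [simp]:
  "vertex_letters i [] = []"
  "vertex_letters i ((j, g) # w) = (if j = i then g # vertex_letters i w else vertex_letters i w)"
  "vertex_letters i (u @ v) = vertex_letters i u @ vertex_letters i v"
  by (simp_all add: vertex_letters_def)

lemma vertex_letters_empty: "i \<notin> fst ` set w \<Longrightarrow> vertex_letters i w = []"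
  by (force simp: vertex_letters_def filter_empty_conv)

lemma vertex_letters_gen:
  "w \<in> gen_words \<Longrightarrow> vertex_letters i w \<in> lists (X i)"
  by (induction w) (auto split: if_splits)

lemma length_eq_sum_vertex_letters:
  "w \<in> gen_words \<Longrightarrow> length w = (\<Sum>i\<in>pverts \<Lambda>. length (vertex_letters i w))"
proof (induction w)
  case (Cons x w)
  obtain j g where x: "x = (j, g)" by (cases x)
  have "(\<Sum>i\<in>pverts \<Lambda>. length (vertex_letters i (x # w))) =
      (\<Sum>i\<in>pverts \<Lambda>. (if i = j then 1 else 0) + length (vertex_letters i w))"
    unfolding x by (intro sum.cong) auto
  then show ?case using Cons x pair_finite_verts by (simp add: sum.distrib)
qed simp

text \<open>The retraction of the graph product onto \<open>G i\<close> that kills all other vertex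
  groups, evaluated on words.\<close>

definition vertex_value :: "'v \<Rightarrow> ('v \<times> 'a) list \<Rightarrow> 'a" where
  "vertex_value i w = word_value (G i) (vertex_letters i w)"

lemma vertex_value_simps [simp]:
  "vertex_value i [] = \<one>\<^bsub>G i\<^esub>"
  "vertex_value i ((j, g) # w) =
     (if j = i then g \<otimes>\<^bsub>G i\<^esub> vertex_value i w else vertex_value i w)"
  by (simp_all add: vertex_value_def word_value_def)

lemma vertex_value_closed [simp]:
  assumes "i \<in> pverts \<Lambda>"
  shows "w \<in> gp_words \<Lambda> G \<Longrightarrow> vertex_value i w \<in> carrier (G i)"
proof (induction w)
  interpret Gi: group "G i" using assms by (rule vertex_group)
  {
    case Nil
    then show ?case by simp
  next
    case (Cons x w)
    then show ?case by (cases x) auto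
  }
qed

lemma vertex_value_append:
  assumes "i \<in> pverts \<Lambda>" "v \<in> gp_words \<Lambda> G"
  shows "u \<in> gp_words \<Lambda> G \<Longrightarrow> vertex_value i (u @ v) = vertex_value i u \<otimes>\<^bsub>G i\<^esub> vertex_value i v"
proof (induction u)
  interpret Gi: group "G i" using assms(1) by (rule vertex_group)
  {
    case Nil
    then show ?case using assms by simp
  next
    case (Cons x u)
    then show ?case using assms by (cases x) (auto simp: Gi.m_assoc)
  }
qed

lemma vertex_value_rel:
  assumes "i \<in> pverts \<Lambda>"
  shows "(v, w) \<in> R \<Longrightarrow> vertex_value i v = vertex_value i w"
proof (induction rule: gp_rel.induct)
  interpret Gi: group "G i" using assms by (rule vertex_group)
  {
    case (mult u v j g h)
    then interpret Gj: group "G j" using vertex_group by blast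
    show ?case using mult assms by (auto simp: vertex_value_append Gi.m_assoc)
  next
    case (one u v j)
    then interpret Gj: group "G j" using vertex_group by blast
    show ?case using one assms by (auto simp: vertex_value_append)
  next
    case (comm u v j k g h)
    have "j \<noteq> k" using comm(3) by auto
    then show ?case using comm assms arc_fst_in_verts[OF comm(3)] arc_snd_in_verts[OF comm(3)]
      by (auto simp: vertex_value_append)
  }
qed auto

section \<open>Words supported on the star of a vertex\<close>

lemma gp_rel_map_Pair:
  assumes "i \<in> pverts \<Lambda>"
  shows "v \<in> lists (carrier (G i)) \<Longrightarrow> (map (Pair i) v, [(i, word_value (G i) v)]) \<in> R"
proof (induction v)
  interpret Gi: group "G i" using assms by (rule vertex_group)
  {
    case Nil
    show ?case using gp_rel.one[of "[]" \<Lambda> G "[]" i] assms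
      by (auto simp: word_value_def intro: gp_rel.sym)
  next
    case (Cons g v)
    have v: "word_value (G i) v \<in> carrier (G i)"
      using Cons.prems by (induction v) (auto simp: word_value_def)
    have "([(i, g)] @ map (Pair i) v @ [], [(i, g)] @ [(i, word_value (G i) v)] @ []) \<in> R"
      using Cons assms by (intro gp_rel_context) auto
    moreover have "([(i, g), (i, word_value (G i) v)], [(i, word_value (G i) (g # v))]) \<in> R"
      using gp_rel.mult[of "[]" \<Lambda> G "[]" i g "word_value (G i) v"] assms Cons.prems v
      by (simp add: word_value_def)
    ultimately show ?case by (auto intro: gp_rel.trans)
  }
qed

lemma gp_rel_commute_past:
  assumes "j \<in> link i" "h \<in> carrier (G j)"
  shows "v \<in> lists (carrier (G i)) \<Longrightarrow> ((j, h) # map (Pair i) v, map (Pair i) v @ [(j, h)]) \<in> R"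
proof (induction v)
  case Nil
  then show ?case using assms link_verts by (auto intro: gp_rel.refl)
next
  case (Cons g v)
  have ij: "(j, i) \<in> parcs \<Lambda>" "i \<in> pverts \<Lambda>" "j \<in> pverts \<Lambda>"
    using assms(1) link_sym link_verts by auto
  have v: "map (Pair i) v \<in> gp_words \<Lambda> G"
    using map_Pair_in_lists_Sigma ij(2) Cons.prems unfolding gp_words_def by fastforce
  have "([] @ [(j, h), (i, g)] @ map (Pair i) v, [] @ [(i, g), (j, h)] @ map (Pair i) v) \<in> R"
    using assms Cons.prems ij v by (intro gp_rel.comm) auto
  moreover have "([(i, g)] @ ((j, h) # map (Pair i) v) @ [],
      [(i, g)] @ (map (Pair i) v @ [(j, h)]) @ []) \<in> R"
    using Cons ij by (intro gp_rel_context) auto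
  ultimately show ?case by (auto intro: gp_rel.trans)
qed

text \<open>A leading letter from the link commutes with the block of \<open>i\<close>-letters and
  is pushed to its right.\<close>

lemma gp_rel_sort_star:
  assumes "i \<in> pverts \<Lambda>"
  shows "w \<in> gp_words \<Lambda> G \<Longrightarrow> fst ` set w \<subseteq> insert i (link i) \<Longrightarrow>
    (w, map (Pair i) (vertex_letters i w) @ restrict_word (link i) w) \<in> R"
proof (induction w)
  case Nil
  then show ?case by (simp add: gp_rel.refl)
next
  case (Cons x w)
  obtain j g where x: "x = (j, g)" by (cases x)
  let ?u = "map (Pair i) (vertex_letters i w)" and ?v = "restrict_word (link i) w"
  have w: "w \<in> gp_words \<Lambda> G" and jg: "j \<in> pverts \<Lambda>" "g \<in> carrier (G j)"
    using Cons.prems x by auto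
  have "([x] @ w @ [], [x] @ (?u @ ?v) @ []) \<in> R"
    using Cons x by (intro gp_rel_context) auto
  then have step: "(x # w, x # ?u @ ?v) \<in> R" by simp
  show ?case
  proof (cases "j = i")
    case True
    then show ?thesis using step x by simp
  next
    case False
    then have j: "j \<in> link i" using Cons.prems x by auto
    have "vertex_letters i w \<in> lists (carrier (G i))"
      using w by (induction w) (auto split: if_splits)
    then have "([] @ ((j, g) # ?u) @ ?v, [] @ (?u @ [(j, g)]) @ ?v) \<in> R"
      using gp_rel_commute_past[OF j jg(2)] w by (intro gp_rel_context) (auto simp: gp_words_filter)
    then show ?thesis using step x j False by (auto intro: gp_rel.trans)
  qed
qed

text \<open>Sorting preserves the length, so a shorter word for the product of the
  \<open>i\<close>-letters, followed by the same link letters, would be shorter than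
  \<open>w\<close>.\<close>

lemma geo_word_star:
  assumes i: "i \<in> pverts \<Lambda>" and w: "geo_word w" "fst ` set w \<subseteq> insert i (link i)"
  shows "geodesic (G i) (X i) (vertex_letters i w)"
proof -
  interpret Gi: finitely_generated "G i" "X i" using i by (rule finitely_generated_vertex)
  have gw: "w \<in> gen_words" using w(1) by (simp add: geo_word_def)
  let ?l = "restrict_word (link i) w"
  have l: "?l \<in> gen_words" using gw by (auto simp: in_lists_conv_set)
  have sorted: "(w, map (Pair i) (vertex_letters i w) @ ?l) \<in> R"
    using gp_rel_sort_star[OF i gen_words_closed[OF gw] w(2)] .
  have len: "length w = length (vertex_letters i w) + length ?l"
    using w(2) by (induction w) auto
  have "length (vertex_letters i w) \<le> length v"
    if v: "v \<in> lists (X i)" "word_value (G i) v = word_value (G i) (vertex_letters i w)" for v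
  proof -
    have "vertex_letters i w \<in> lists (carrier (G i))" "v \<in> lists (carrier (G i))"
      using Gi.gens_closed vertex_letters_gen[OF gw] v(1) by (auto simp: in_lists_conv_set)
    then have "(map (Pair i) v, map (Pair i) (vertex_letters i w)) \<in> R"
      using gp_rel_map_Pair[OF i] v(2) gp_rel.sym gp_rel.trans by metis
    then have "(map (Pair i) v @ ?l, map (Pair i) (vertex_letters i w) @ ?l) \<in> R"
      using gp_rel_append gp_rel.refl gen_words_closed[OF l] by blast
    then have "(map (Pair i) v @ ?l, w) \<in> R" using sorted gp_rel.sym gp_rel.trans by metis
    moreover have "map (Pair i) v @ ?l \<in> gen_words"
      using map_Pair_in_lists_Sigma[OF i, of v X] v(1) l by simp
    ultimately have "length w \<le> length (map (Pair i) v @ ?l)"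
      using w(1) unfolding geo_word_def by blast
    then show ?thesis using len by simp
  qed
  then show ?thesis using vertex_letters_gen[OF gw] by (auto simp: Gi.geodesic_iff)
qed

lemma geo_word_vertex_value:
  assumes "i \<in> pverts \<Lambda>" "geo_word w" "fst ` set w \<subseteq> insert i (link i)"
  shows "elt_length (G i) (X i) (vertex_value i w) = length (vertex_letters i w)"
  using geo_word_star[OF assms] by (simp add: geodesic_def vertex_value_def)

section \<open>An action on normal forms of a free product\<close>

context
  fixes i assumes i_vert: "i \<in> pverts \<Lambda>"
begin

interpretation Gi: finitely_generated "G i" "X i"
  using i_vert by (rule finitely_generated_vertex)

text \<open>
  The subgroup generated by the vertex groups adjacent to \<open>i\<close>. The action below only looks at the
  left cosets of this subgroup, but all subsets of the carrier are allowed as labels.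
\<close>

definition base :: "('v \<times> 'a) list set set" where
  "base = (\<lambda>w. cls w) ` {w \<in> gp_words \<Lambda> G. fst ` set w \<subseteq> link i}"

lemma base_closed: "base \<subseteq> carrier P"
  by (auto simp: base_def)

lemma translate_base:
  assumes "j \<in> link i" "h \<in> carrier (G j)"
  shows "gp_incl \<Lambda> G j h <#\<^bsub>P\<^esub> base = base"
proof -
  have j: "j \<in> pverts \<Lambda>" using assms(1) by (rule link_verts)
  interpret Gj: group "G j" using j by (rule vertex_group)
  have sub: "gp_incl \<Lambda> G j g <#\<^bsub>P\<^esub> base \<subseteq> base" if g: "g \<in> carrier (G j)" for g
  proof
    fix y assume "y \<in> gp_incl \<Lambda> G j g <#\<^bsub>P\<^esub> base"
    then obtain w where w: "w \<in> gp_words \<Lambda> G" "fst ` set w \<subseteq> link i"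
      "y = gp_incl \<Lambda> G j g \<otimes>\<^bsub>P\<^esub> cls w"
      by (auto simp: l_coset_def base_def)
    then have "y = cls ((j, g) # w)" using gp_class_Cons[of j g w] j g by simp
    then show "y \<in> base" unfolding base_def using w assms(1) j g
      by (intro image_eqI[of _ _ "(j, g) # w"]) auto
  qed
  let ?a = "gp_incl \<Lambda> G j h" and ?b = "gp_incl \<Lambda> G j (inv\<^bsub>G j\<^esub> h)"
  have ab: "?a \<in> carrier P" "?b \<in> carrier P" "?a \<otimes>\<^bsub>P\<^esub> ?b = \<one>\<^bsub>P\<^esub>"
    using assms j by (simp_all add: gp_incl_closed gp_incl_mult[symmetric] gp_incl_one)
  \<comment> \<open>The other inclusion comes from the inverse letter, which also maps
    \<open>base\<close> into itself.\<close>
  have "base = ?a <#\<^bsub>P\<^esub> (?b <#\<^bsub>P\<^esub> base)"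
    using ab base_closed by (simp add: P.lcos_m_assoc P.lcos_mult_one)
  also have "\<dots> \<subseteq> ?a <#\<^bsub>P\<^esub> base"
    using sub[of "inv\<^bsub>G j\<^esub> h"] assms(2) by (auto simp: l_coset_def)
  finally show ?thesis using sub[OF assms(2)] by blast
qed

lemma translate_base_word:
  "w \<in> gp_words \<Lambda> G \<Longrightarrow> fst ` set w \<subseteq> link i \<Longrightarrow> cls w <#\<^bsub>P\<^esub> base = base"
proof (induction w)
  case Nil
  then show ?case using P.lcos_mult_one[OF base_closed] by (simp add: gp_one)
next
  case (Cons x w)
  obtain j h where x: "x = (j, h)" by (cases x)
  show ?case using Cons x base_closed
    by (simp add: gp_class_Cons P.lcos_m_assoc[symmetric] gp_incl_closed translate_base)
qed

text \<open>An element of the link subgroup is unchanged when letters outside the link are erased. A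
  geodesic word for it therefore has no such letters, so \<open>u\<close> cannot stabilize
  \<open>base\<close>.\<close>

lemma translate_base_moves:
  assumes "geo_word u" "\<not> fst ` set u \<subseteq> link i"
  shows "cls u <#\<^bsub>P\<^esub> base \<noteq> base"
proof
  assume eq: "cls u <#\<^bsub>P\<^esub> base = base"
  have gu: "u \<in> gen_words" using assms(1) by (simp add: geo_word_def)
  then have u: "u \<in> gp_words \<Lambda> G" by (rule gen_words_closed)
  have "\<one>\<^bsub>P\<^esub> \<in> base" by (auto simp: base_def gp_one)
  then have "cls u \<otimes>\<^bsub>P\<^esub> \<one>\<^bsub>P\<^esub> \<in> base" using eq by (auto simp: l_coset_def)
  then have "cls u \<in> base" using u P.r_one by simp
  then obtain v where v: "v \<in> gp_words \<Lambda> G" "fst ` set v \<subseteq> link i" "cls u = cls v"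
    by (auto simp: base_def)
  then have uv: "(u, v) \<in> R" using u gp_class_eq_iff by blast
  moreover have "restrict_word (link i) v = v" using v(2) by (auto simp: filter_id_conv)
  ultimately have "(restrict_word (link i) u, u) \<in> R"
    using gp_rel_restrict[OF uv, of "link i"] by (metis gp_rel.sym gp_rel.trans)
  moreover have "restrict_word (link i) u \<in> gen_words" using gu by (auto simp: in_lists_conv_set)
  ultimately have "length u \<le> length (restrict_word (link i) u)"
    using assms(1) unfolding geo_word_def by blast
  moreover have "length (restrict_word (link i) u) < length u"
    using assms(2) by (auto intro!: length_filter_less)
  ultimately show False by simp
qed

lemma translate_eq_iff:
  assumes "a \<in> carrier P" "A \<subseteq> carrier P" "B \<subseteq> carrier P"
  shows "a <#\<^bsub>P\<^esub> A = a <#\<^bsub>P\<^esub> B \<longleftrightarrow> A = B"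
proof
  assume "a <#\<^bsub>P\<^esub> A = a <#\<^bsub>P\<^esub> B"
  then have "inv\<^bsub>P\<^esub> a <#\<^bsub>P\<^esub> (a <#\<^bsub>P\<^esub> A) = inv\<^bsub>P\<^esub> a <#\<^bsub>P\<^esub> (a <#\<^bsub>P\<^esub> B)" by simp
  then show "A = B" using assms by (simp add: P.lcos_m_assoc P.lcos_mult_one)
qed simp

text \<open>
  A list of pairs \<open>(A, h)\<close> is a normal form in the free product of copies of \<open>G i\<close>, one copy for each
  label \<open>A\<close>. Letters of \<open>i\<close> multiply from the left in the copy labelled \<open>base\<close>, and all other
  letters act by left translation of the labels.
\<close>

definition reduced :: "(('v \<times> 'a) list set set \<times> 'a) list \<Rightarrow> bool" where
  "reduced l \<longleftrightarrow>
     set l \<subseteq> Pow (carrier P) \<times> (carrier (G i) - {\<one>\<^bsub>G i\<^esub>}) \<and> distinct_adj (map fst l)"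

text \<open>A list that does not start with a syllable labelled \<open>base\<close> is read as
  starting with a trivial one, and \<open>put_base\<close> drops a trivial syllable again, so that
  \<open>G i\<close> acts uniformly.\<close>

definition base_coeff :: "(('v \<times> 'a) list set set \<times> 'a) list \<Rightarrow> 'a" where
  "base_coeff l = (if l \<noteq> [] \<and> fst (hd l) = base then snd (hd l) else \<one>\<^bsub>G i\<^esub>)"

definition base_rest ::
  "(('v \<times> 'a) list set set \<times> 'a) list \<Rightarrow> (('v \<times> 'a) list set set \<times> 'a) list" where
  "base_rest l = (if l \<noteq> [] \<and> fst (hd l) = base then tl l else l)"

definition put_base ::
  "'a \<Rightarrow> (('v \<times> 'a) list set set \<times> 'a) list \<Rightarrow> (('v \<times> 'a) list set set \<times> 'a) list" where
  "put_base s l = (if s = \<one>\<^bsub>G i\<^esub> then l else (base, s) # l)"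

definition translate ::
  "('v \<times> 'a) list set \<Rightarrow> (('v \<times> 'a) list set set \<times> 'a) list \<Rightarrow>
   (('v \<times> 'a) list set set \<times> 'a) list" where
  "translate a = map (\<lambda>(A, h). (a <#\<^bsub>P\<^esub> A, h))"

definition act_letter ::
  "'v \<times> 'a \<Rightarrow> (('v \<times> 'a) list set set \<times> 'a) list \<Rightarrow> (('v \<times> 'a) list set set \<times> 'a) list" where
  "act_letter x l =
     (if fst x = i then put_base (snd x \<otimes>\<^bsub>G i\<^esub> base_coeff l) (base_rest l)
      else translate (gp_incl \<Lambda> G (fst x) (snd x)) l)"

definition act ::
  "('v \<times> 'a) list \<Rightarrow> (('v \<times> 'a) list set set \<times> 'a) list \<Rightarrow> (('v \<times> 'a) list set set \<times> 'a) list"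
  where "act w l = foldr act_letter w l"

lemma act_simps [simp]:
  "act [] l = l" "act (x # w) l = act_letter x (act w l)" "act (u @ v) l = act u (act v l)"
  by (simp_all add: act_def)

lemma reduced_Nil [simp]: "reduced []"
  by (simp add: reduced_def)

lemma base_coeff_closed: "reduced l \<Longrightarrow> base_coeff l \<in> carrier (G i)"
  by (cases l) (auto simp: reduced_def base_coeff_def)

lemma reduced_base_rest: "reduced l \<Longrightarrow> reduced (base_rest l)"
  by (cases l) (auto simp: reduced_def base_rest_def distinct_adj_Cons)

lemma put_base_coeff_rest: "reduced l \<Longrightarrow> put_base (base_coeff l) (base_rest l) = l"
  by (cases l) (auto simp: reduced_def base_rest_def base_coeff_def put_base_def)

text \<open>Neighbouring labels of a reduced list differ, so \<open>base_rest l\<close> does not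
  start with \<open>base\<close> and a new syllable fits in front.\<close>

lemma reduced_put_base:
  "reduced l \<Longrightarrow> s \<in> carrier (G i) \<Longrightarrow> reduced (put_base s (base_rest l))"
  using base_closed by (cases l; cases "tl l")
    (auto simp: reduced_def base_rest_def put_base_def distinct_adj_Cons)

lemma base_coeff_put_base: "reduced l \<Longrightarrow> base_coeff (put_base s (base_rest l)) = s"
  by (cases l; cases "tl l")
    (auto simp: reduced_def base_rest_def put_base_def base_coeff_def distinct_adj_Cons)

lemma base_rest_put_base: "reduced l \<Longrightarrow> base_rest (put_base s (base_rest l)) = base_rest l"
  by (cases l; cases "tl l")
    (auto simp: reduced_def base_rest_def put_base_def base_coeff_def distinct_adj_Cons)

lemma reduced_translate:
  assumes "reduced l" "a \<in> carrier P"
  shows "reduced (translate a l)"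
proof -
  have "distinct_adj (map (\<lambda>A. a <#\<^bsub>P\<^esub> A) (map fst l))"
  proof (rule distinct_adj_mapI[OF _ inj_onI])
    show "distinct_adj (map fst l)" using assms(1) by (simp add: reduced_def)
    fix A B assume "A \<in> set (map fst l)" "B \<in> set (map fst l)"
    then have "A \<subseteq> carrier P" "B \<subseteq> carrier P" using assms(1) by (auto simp: reduced_def)
    then show "a <#\<^bsub>P\<^esub> A = a <#\<^bsub>P\<^esub> B \<Longrightarrow> A = B" using translate_eq_iff[OF assms(2)] by blast
  qed
  moreover have "map fst (translate a l) = map (\<lambda>A. a <#\<^bsub>P\<^esub> A) (map fst l)"
    by (auto simp: translate_def)
  moreover have "a <#\<^bsub>P\<^esub> A \<in> Pow (carrier P)" "h \<in> carrier (G i) - {\<one>\<^bsub>G i\<^esub>}"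
    if "(A, h) \<in> set l" for A h
    using that assms P.l_coset_subset_G[of A a] unfolding reduced_def by blast+
  then have "set (translate a l) \<subseteq> Pow (carrier P) \<times> (carrier (G i) - {\<one>\<^bsub>G i\<^esub>})"
    unfolding translate_def by fastforce
  ultimately show ?thesis unfolding reduced_def by simp
qed

lemma translate_mult:
  assumes "reduced l" "a \<in> carrier P" "b \<in> carrier P"
  shows "translate a (translate b l) = translate (a \<otimes>\<^bsub>P\<^esub> b) l"
  using assms by (auto simp: translate_def reduced_def P.lcos_m_assoc)

lemma translate_one: "reduced l \<Longrightarrow> translate \<one>\<^bsub>P\<^esub> l = l"
  unfolding translate_def by (rule map_idI) (auto simp: reduced_def P.lcos_mult_one)

text \<open>A link letter fixes \<open>base\<close> and, by injectivity, moves no other label to it,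
  so it commutes with splitting off and restoring the syllable at \<open>base\<close>.\<close>

lemma translate_link:
  assumes "j \<in> link i" "h \<in> carrier (G j)" "reduced l"
  shows "base_coeff (translate (gp_incl \<Lambda> G j h) l) = base_coeff l"
    and "base_rest (translate (gp_incl \<Lambda> G j h) l) = translate (gp_incl \<Lambda> G j h) (base_rest l)"
    and "translate (gp_incl \<Lambda> G j h) (put_base s l) = put_base s (translate (gp_incl \<Lambda> G j h) l)"
proof -
  have "gp_incl \<Lambda> G j h \<in> carrier P" using assms link_verts gp_incl_closed by blast
  then have "gp_incl \<Lambda> G j h <#\<^bsub>P\<^esub> A = base \<longleftrightarrow> A = base" if "A \<subseteq> carrier P" for A
    using translate_eq_iff[OF _ that base_closed] translate_base[OF assms(1,2)] by metis
  then show "base_coeff (translate (gp_incl \<Lambda> G j h) l) = base_coeff l"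
    and "base_rest (translate (gp_incl \<Lambda> G j h) l) = translate (gp_incl \<Lambda> G j h) (base_rest l)"
    using assms(3)
    by (cases l; force simp: translate_def base_coeff_def base_rest_def reduced_def)+
  show "translate (gp_incl \<Lambda> G j h) (put_base s l) = put_base s (translate (gp_incl \<Lambda> G j h) l)"
    using translate_base[OF assms(1,2)] by (simp add: translate_def put_base_def)
qed

section \<open>The graph product acts on reduced lists\<close>

lemma reduced_act_letter:
  assumes "reduced l" "j \<in> pverts \<Lambda>" "g \<in> carrier (G j)"
  shows "reduced (act_letter (j, g) l)"
  using assms base_coeff_closed
  by (auto simp: act_letter_def gp_incl_closed intro!: reduced_put_base reduced_translate)

lemma reduced_act: "w \<in> gp_words \<Lambda> G \<Longrightarrow> reduced l \<Longrightarrow> reduced (act w l)"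
  by (induction w) (auto intro: reduced_act_letter)

lemma act_letter_commute:
  assumes "(j, k) \<in> parcs \<Lambda>" "g \<in> carrier (G j)" "h \<in> carrier (G k)" "reduced l"
  shows "act_letter (j, g) (act_letter (k, h) l) = act_letter (k, h) (act_letter (j, g) l)"
proof -
  have vs: "j \<in> pverts \<Lambda>" "k \<in> pverts \<Lambda>" "j \<noteq> k" using assms(1) link_verts link_sym by auto
  consider "j = i" | "k = i" | "j \<noteq> i" "k \<noteq> i" by blast
  then show ?thesis
  proof cases
    case 1
    then show ?thesis using translate_link[of k h] assms vs reduced_base_rest
      by (simp add: act_letter_def)
  next
    case 2
    then have "j \<in> link i" using assms(1) link_sym by simp
    then show ?thesis using 2 translate_link[of j g] assms vs reduced_base_rest
      by (simp add: act_letter_def)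
  next
    case 3
    then show ?thesis using assms vs gp_incl_commute[OF assms(1-3)]
      by (simp add: act_letter_def translate_mult gp_incl_closed)
  qed
qed

text \<open>Each defining relation holds for the operators on reduced lists. Within one vertex it
  comes from the group law of \<open>G i\<close> on the \<open>base\<close> coefficient, or from
  that of \<open>P\<close> on the labels; commutation is \<open>act_letter_commute\<close>.\<close>

lemma act_rel: "(v, w) \<in> R \<Longrightarrow> reduced l \<Longrightarrow> act v l = act w l"
proof (induction arbitrary: l rule: gp_rel.induct)
  case (mult u v j g h)
  have red: "reduced (act v l)" using mult reduced_act by blast
  have "act_letter (j, g) (act_letter (j, h) m) = act_letter (j, g \<otimes>\<^bsub>G j\<^esub> h) m" if "reduced m" for m
    using mult that base_coeff_closed[OF that]
    by (auto simp: act_letter_def translate_mult gp_incl_mult gp_incl_closed base_coeff_put_base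
        base_rest_put_base Gi.m_assoc)
  then show ?case using red by simp
next
  case (one u v j)
  have red: "reduced (act v l)" using one reduced_act by blast
  have "act_letter (j, \<one>\<^bsub>G j\<^esub>) m = m" if "reduced m" for m
    using one that base_coeff_closed[OF that]
    by (auto simp: act_letter_def translate_one gp_incl_one put_base_coeff_rest)
  then show ?case using red by simp
next
  case (comm u v j k g h)
  have "reduced (act v l)" using comm reduced_act by blast
  from act_letter_commute[OF comm(3-5) this] show ?case by simp
qed auto

section \<open>Weights of normal forms\<close>

definition weight :: "(('v \<times> 'a) list set set \<times> 'a) list \<Rightarrow> nat" where
  "weight l = (\<Sum>x\<leftarrow>l. elt_length (G i) (X i) (snd x))"

text \<open>The conjugating words may contain arbitrary elements of \<open>G i\<close>, so an
  \<open>i\<close>-letter is counted with its length in \<open>G i\<close>; a generator counts at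
  most one.\<close>

definition cost :: "('v \<times> 'a) list \<Rightarrow> nat" where
  "cost w = (\<Sum>g\<leftarrow>vertex_letters i w. elt_length (G i) (X i) g)"

lemma weight_simps [simp]:
  "weight [] = 0" "weight (x # l) = elt_length (G i) (X i) (snd x) + weight l"
  by (simp_all add: weight_def)

lemma weight_put_base [simp]: "weight (put_base s l) = elt_length (G i) (X i) s + weight l"
  by (simp add: put_base_def)

lemma weight_translate [simp]: "weight (translate a l) = weight l"
  by (induction l) (auto simp: translate_def)

text \<open>An \<open>i\<close>-letter multiplies one coefficient, so the triangle inequality in
  \<open>G i\<close> bounds the increase; other letters only change labels.\<close>

lemma weight_act_le:
  "w \<in> gp_words \<Lambda> G \<Longrightarrow> reduced l \<Longrightarrow> weight (act w l) \<le> cost w + weight l"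
proof (induction w)
  case Nil
  then show ?case by simp
next
  case (Cons x w)
  obtain j g where x: "x = (j, g)" by (cases x)
  let ?m = "act w l"
  have m: "reduced ?m" "weight ?m \<le> cost w + weight l"
    using Cons x reduced_act by auto
  show ?case
  proof (cases "j = i")
    case True
    have "elt_length (G i) (X i) (g \<otimes>\<^bsub>G i\<^esub> base_coeff ?m)
        \<le> elt_length (G i) (X i) g + elt_length (G i) (X i) (base_coeff ?m)"
      using Cons.prems x True base_coeff_closed[OF m(1)] by (intro Gi.elt_length_mult) auto
    moreover have "weight ?m = elt_length (G i) (X i) (base_coeff ?m) + weight (base_rest ?m)"
      using put_base_coeff_rest[OF m(1)] weight_put_base by metis
    ultimately show ?thesis using m(2) x True by (simp add: act_letter_def cost_def)
  next
    case False
    then show ?thesis using m(2) x by (simp add: act_letter_def cost_def)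
  qed
qed

lemma cost_gen_words:
  "w \<in> gen_words \<Longrightarrow> cost w \<le> length (vertex_letters i w)"
proof (induction w)
  case (Cons x w)
  then show ?case using Gi.elt_length_generator by (cases x) (fastforce simp: cost_def)
qed (simp add: cost_def)

lemma cost_append: "cost (u @ v) = cost u + cost v"
  by (simp add: cost_def)

lemma cost_power: "cost (concat (replicate n w)) = n * cost w"
  by (induction n) (simp_all add: cost_append cost_def)

text \<open>Powers of a cyclically geodesic word are in general not geodesic, but these two kinds of
  factors will be. Star factors give the length of a syllable; factors without \<open>i\<close> show
  that a label has left \<open>base\<close>.\<close>

definition locally_geodesic :: "('v \<times> 'a) list \<Rightarrow> bool" where
  "locally_geodesic w \<longleftrightarrow> w \<in> gen_words \<and>
     (\<forall>p u q. w = p @ u @ q \<longrightarrow> fst ` set u \<subseteq> insert i (link i) \<or> i \<notin> fst ` set u \<longrightarrow> geo_word u)"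

lemma locally_geodesicD:
  assumes "locally_geodesic w"
  shows "w \<in> gen_words"
    and "w = p @ u @ q \<Longrightarrow> fst ` set u \<subseteq> insert i (link i) \<Longrightarrow> geo_word u"
    and "w = p @ u @ q \<Longrightarrow> i \<notin> fst ` set u \<Longrightarrow> geo_word u"
  using assms unfolding locally_geodesic_def by blast+

lemma locally_geodesic_ConsD: "locally_geodesic (x # w) \<Longrightarrow> locally_geodesic w"
  unfolding locally_geodesic_def by (metis Cons_in_lists_iff append.simps(2))

text \<open>
  The first syllable of \<open>act w []\<close> collects the letters of \<open>i\<close> in \<open>v\<close>. The next letter of \<open>i\<close> joins
  this syllable if only letters adjacent to \<open>i\<close> separate it from \<open>v\<close>. Otherwise the label of the
  syllable has moved away from \<open>base\<close> and a new syllable is opened.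
\<close>

lemma act_syllables:
  assumes "locally_geodesic w"
  shows "(i \<notin> fst ` set w \<and> act w [] = []) \<or>
    (\<exists>u v z r. w = u @ v @ z \<and> i \<notin> fst ` set u \<and> fst ` set v \<subseteq> insert i (link i) \<and>
       act w [] = (cls u <#\<^bsub>P\<^esub> base, vertex_value i v) # r \<and>
       length (vertex_letters i v) + weight r = length (vertex_letters i w))"
  using assms
proof (induction w rule: list.induct)
  case Nil
  then show ?case by simp
next
  case (Cons x w)
  obtain j g where x: "x = (j, g)" by (cases x)
  note factor = locally_geodesicD(2,3)[OF Cons.prems]
  note IH = Cons.IH[OF locally_geodesic_ConsD[OF Cons.prems]]
  have xw: "x # w \<in> gp_words \<Lambda> G"
    using locally_geodesicD(1)[OF Cons.prems] by (rule gen_words_closed)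
  then have gw: "w \<in> gp_words \<Lambda> G" using x by simp
  have gx: "j \<in> pverts \<Lambda>" "g \<in> carrier (G j)" using xw x by simp_all
  show ?case
  proof (cases "j = i")
    case False
    from IH show ?thesis
    proof (elim disjE exE conjE)
      assume "i \<notin> fst ` set w" "act w [] = []"
      then show ?thesis using x False by (auto simp: act_letter_def translate_def)
    next
      fix u v z r
      assume w: "w = u @ v @ z" "i \<notin> fst ` set u" "fst ` set v \<subseteq> insert i (link i)"
        "act w [] = (cls u <#\<^bsub>P\<^esub> base, vertex_value i v) # r"
        "length (vertex_letters i v) + weight r = length (vertex_letters i w)"
      have "u \<in> gp_words \<Lambda> G" using w gw by simp
      \<comment> \<open>A letter of another vertex moves the label along: it extends
        \<open>u\<close>, while the block \<open>v\<close> keeps its value.\<close>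
      then have "cls (x # u) <#\<^bsub>P\<^esub> base = gp_incl \<Lambda> G j g <#\<^bsub>P\<^esub> (cls u <#\<^bsub>P\<^esub> base)"
        using gx x base_closed by (simp add: gp_class_Cons P.lcos_m_assoc gp_incl_closed)
      then have "act (x # w) [] =
          (cls (x # u) <#\<^bsub>P\<^esub> base, vertex_value i v) # translate (gp_incl \<Lambda> G j g) r"
        using w(4) x False by (simp add: act_letter_def translate_def)
      then show ?thesis using w x False
        by (intro disjI2 exI[of _ "x # u"] exI[of _ v] exI[of _ z]
            exI[of _ "translate (gp_incl \<Lambda> G j g) r"]) auto
    qed
  next
    case True
    \<comment> \<open>The star factor is geodesic and contains the \<open>i\<close>-letter
      \<open>x\<close>, so its value has positive length and \<open>put_base\<close> does not drop
      the syllable.\<close>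
    have nontrivial: "vertex_value i (x # v) \<noteq> \<one>\<^bsub>G i\<^esub>"
      if "x # w = (x # v) @ z" "fst ` set (x # v) \<subseteq> insert i (link i)" for v z
    proof -
      have "geo_word (x # v)" using factor[of "[]" "x # v" z] that by simp
      then have "elt_length (G i) (X i) (vertex_value i (x # v)) \<noteq> 0"
        using geo_word_vertex_value[OF i_vert _ that(2)] x True
        by (simp del: vertex_value_simps)
      then show ?thesis by auto
    qed
    have nil: "cls [] <#\<^bsub>P\<^esub> base = base"
      using P.lcos_mult_one[OF base_closed] by (simp add: gp_one)
    \<comment> \<open>If no syllable at \<open>base\<close> is in front, \<open>x\<close> opens a
      new one: \<open>u = []\<close>, \<open>v = [x]\<close>, and the whole old list becomes the
      rest.\<close>
    have fresh: ?thesis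
      if "base_coeff (act w []) = \<one>\<^bsub>G i\<^esub>" "base_rest (act w []) = act w []"
        "weight (act w []) = length (vertex_letters i w)"
    proof -
      have val: "vertex_value i [x] = g" using x True gx by auto
      have "g \<noteq> \<one>\<^bsub>G i\<^esub>" using nontrivial[of "[]" w] x True val by auto
      then have "act (x # w) [] = (cls [] <#\<^bsub>P\<^esub> base, vertex_value i [x]) # act w []"
        using that x True gx by (simp only: nil val) (simp add: act_letter_def put_base_def)
      then show ?thesis using that(3) x True
        by (intro disjI2 exI[of _ "[]"] exI[of _ "[x]"] exI[of _ w] exI[of _ "act w []"]) auto
    qed
    from IH show ?thesis
    proof (elim disjE exE conjE)
      assume "i \<notin> fst ` set w" "act w [] = []"
      then show ?thesis
        by (intro fresh) (auto simp: base_coeff_def base_rest_def vertex_letters_empty)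
    next
      fix u v z r
      assume w: "w = u @ v @ z" "i \<notin> fst ` set u" "fst ` set v \<subseteq> insert i (link i)"
        "act w [] = (cls u <#\<^bsub>P\<^esub> base, vertex_value i v) # r"
        "length (vertex_letters i v) + weight r = length (vertex_letters i w)"
      have words: "u \<in> gp_words \<Lambda> G" "v \<in> gp_words \<Lambda> G" using w gw by auto
      have "geo_word v" using factor[of "x # u" v z] w by simp
      then have len_v: "elt_length (G i) (X i) (vertex_value i v) = length (vertex_letters i v)"
        using geo_word_vertex_value[OF i_vert] w(3) by blast
      show ?thesis
      proof (cases "fst ` set u \<subseteq> link i")
        case u_link: True
        \<comment> \<open>The letters of \<open>u\<close> lie in the link, so the label is still
          \<open>base\<close> and \<open>x\<close> joins the syllable; \<open>u\<close> itself
          contributes nothing to its value.\<close>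
        have val: "vertex_value i (x # u @ v) = g \<otimes>\<^bsub>G i\<^esub> vertex_value i v"
          using x True words i_vert vertex_letters_empty[OF w(2)] gx
          by (simp add: vertex_value_append vertex_value_def[of i u] word_value_def[of _ "[]"])
        have star: "fst ` set (x # u @ v) \<subseteq> insert i (link i)" using u_link w(3) x True by auto
        have "act (x # w) [] = (cls [] <#\<^bsub>P\<^esub> base, vertex_value i (x # u @ v)) # r"
          using w(4) translate_base_word[OF words(1) u_link] nontrivial[of "u @ v" z] w(1) star
          using x True unfolding nil val
          by (simp add: act_letter_def base_coeff_def base_rest_def put_base_def)
        then show ?thesis using w x True star vertex_letters_empty[OF w(2)]
          by (intro disjI2 exI[of _ "[]"] exI[of _ "x # u @ v"] exI[of _ z] exI[of _ r]) auto
      next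
        case False
        \<comment> \<open>A factor without \<open>i\<close> is geodesic; as \<open>u\<close> has a
          letter outside the link, it moves the label away from \<open>base\<close>.\<close>
        have "geo_word u" using factor[of "[x]" u "v @ z"] w by simp
        then have "cls u <#\<^bsub>P\<^esub> base \<noteq> base" using translate_base_moves False by blast
        then show ?thesis using w(4,5) len_v
          by (intro fresh) (auto simp: base_coeff_def base_rest_def)
      qed
    qed
  qed
qed

lemma weight_act:
  assumes "locally_geodesic w"
  shows "weight (act w []) = length (vertex_letters i w)"
  using act_syllables[OF assms]
proof (elim disjE exE conjE)
  fix u v z r
  assume w: "w = u @ v @ z" "fst ` set v \<subseteq> insert i (link i)"
    "act w [] = (cls u <#\<^bsub>P\<^esub> base, vertex_value i v) # r"
    "length (vertex_letters i v) + weight r = length (vertex_letters i w)"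
  have "geo_word v" using locally_geodesicD(2)[OF assms] w by blast
  then show ?thesis using geo_word_vertex_value[OF i_vert] w by simp
qed (simp add: vertex_letters_empty)

end

section \<open>Counting the letters of one vertex\<close>

lemma conjugate_words:
  assumes "conjugate P (cls w) (cls v)" "v \<in> gp_words \<Lambda> G" "w \<in> gp_words \<Lambda> G"
  obtains a b where "a \<in> gp_words \<Lambda> G" "b \<in> gp_words \<Lambda> G" "(a @ b, []) \<in> R" "(b @ a, []) \<in> R"
    "(v, a @ w @ b) \<in> R" "(w, b @ v @ a) \<in> R"
proof -
  obtain x where x: "x \<in> carrier P" "cls v = x \<otimes>\<^bsub>P\<^esub> cls w \<otimes>\<^bsub>P\<^esub> inv\<^bsub>P\<^esub> x"
    using assms(1) unfolding conjugate_def by blast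
  obtain a b where a: "a \<in> gp_words \<Lambda> G" "x = cls a" and b: "b \<in> gp_words \<Lambda> G" "inv\<^bsub>P\<^esub> x = cls b"
    using x(1) P.inv_closed[OF x(1)] unfolding gp_carrier by blast
  have v: "cls v = cls (a @ w @ b)"
    using x(2)[unfolded b(2), unfolded a(2)] a(1) b(1) assms(3) by (simp add: gp_mult_class)
  have "cls w = inv\<^bsub>P\<^esub> x \<otimes>\<^bsub>P\<^esub> cls v \<otimes>\<^bsub>P\<^esub> x"
    using x cls_closed[OF assms(3)] by (simp add: P.m_assoc) (simp add: P.m_assoc[symmetric])
  from this[unfolded b(2), unfolded a(2)] have w: "cls w = cls (b @ v @ a)"
    using a(1) b(1) assms(2) by (simp add: gp_mult_class)
  have "cls (a @ b) = cls []" "cls (b @ a) = cls []"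
    using P.r_inv[OF x(1), unfolded b(2), unfolded a(2)]
      P.l_inv[OF x(1), unfolded b(2), unfolded a(2)] a(1) b(1)
    by (simp_all add: gp_mult_class gp_one)
  then show thesis using that[OF a(1) b(1)] v w a b assms by (simp add: gp_class_eq_iff)
qed

text \<open>Between consecutive copies of \<open>b @ v @ a\<close> the factor \<open>a @ b\<close>
  cancels.\<close>

lemma gp_rel_conjugate_power:
  assumes "(w, b @ v @ a) \<in> R" "(b @ a, []) \<in> R" "(a @ b, []) \<in> R"
  shows "(concat (replicate n w), b @ concat (replicate n v) @ a) \<in> R"
proof (induction n)
  case 0
  then show ?case using assms(2) by (auto intro: gp_rel.sym)
next
  case (Suc n)
  let ?vn = "concat (replicate n v)"
  have words: "b @ v \<in> gp_words \<Lambda> G" "?vn @ a \<in> gp_words \<Lambda> G"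
    using gp_rel_words(2)[OF assms(1)] gp_rel_words(2)[OF Suc.IH] by auto
  have "(w @ concat (replicate n w), (b @ v @ a) @ b @ ?vn @ a) \<in> R"
    using assms(1) Suc.IH by (rule gp_rel_append)
  moreover have "((b @ v) @ (a @ b) @ ?vn @ a, (b @ v) @ [] @ ?vn @ a) \<in> R"
    using assms(3) words by (rule gp_rel_context)
  ultimately show ?case by (auto intro: gp_rel.trans)
qed

text \<open>A factor inside the star, or without \<open>i\<close>, misses a letter of
  \<open>w\<close>. It is therefore shorter than the period and a prefix of a rotation of
  \<open>w\<close>, which is geodesic.\<close>

lemma periodic_locally_geodesic:
  assumes cyc: "\<And>n. geo_word (rotate n w)"
    and i: "i \<in> pverts \<Lambda>" "i \<in> fst ` set w" "\<not> fst ` set w \<subseteq> insert i (link i)"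
  shows "locally_geodesic i (concat (replicate n w))"
proof -
  have "w \<in> gen_words" using cyc[of 0] by (simp add: geo_word_def)
  then have "concat (replicate n w) \<in> gen_words" by (induction n) auto
  moreover have "geo_word u"
    if u: "concat (replicate n w) = p @ u @ q"
      "fst ` set u \<subseteq> insert i (link i) \<or> i \<notin> fst ` set u" for p u q
  proof -
    have "\<not> set w \<subseteq> set u" using u(2) i by blast
    then have "length u \<le> length w" using periodic_factor_long[OF u(1)] by linarith
    from periodic_factor_short[OF u(1) this]
    have "rotate (length p) w = [] @ u @ drop (length u) (rotate (length p) w)"
      by (metis append.simps(1) append_take_drop_id)
    then show ?thesis using geo_word_factor cyc by metis
  qed
  ultimately show ?thesis unfolding locally_geodesic_def[OF i(1)] by blast
qed

lemma le_if_multiples_le: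
  fixes p q c :: nat
  assumes "\<And>n. n * p \<le> n * q + c"
  shows "p \<le> q"
proof (rule ccontr)
  assume "\<not> p \<le> q"
  \<comment> \<open>With \<open>n = c + 1\<close>, a gap of at least one between \<open>q\<close>
    and \<open>p\<close> adds up to more than \<open>c\<close>.\<close>
  then have "Suc c * Suc q \<le> Suc c * p" by (intro mult_le_mono2) simp
  also have "\<dots> \<le> Suc c * q + c" by (rule assms)
  finally show False by simp
qed

text \<open>The words \<open>w^n\<close> and \<open>b v^n a\<close> act alike on the empty normal
  form. The resulting weight is exactly \<open>n\<close> times the count for \<open>w\<close> and at
  most \<open>n\<close> times that for \<open>v\<close>, up to a constant from \<open>a\<close> and
  \<open>b\<close>.\<close>

lemma vertex_count_nonisolated:
  assumes cyc: "\<And>n. geo_word (rotate n w)" and v: "v \<in> gen_words"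
    and conj: "conjugate P (cls w) (cls v)"
    and i: "i \<in> pverts \<Lambda>" "\<not> fst ` set w \<subseteq> insert i (link i)"
  shows "length (vertex_letters i w) \<le> length (vertex_letters i v)"
proof (cases "i \<in> fst ` set w")
  case False
  then show ?thesis by (simp add: vertex_letters_empty)
next
  case True
  have w: "w \<in> gen_words" using cyc[of 0] by (simp add: geo_word_def)
  obtain a b where ab: "a \<in> gp_words \<Lambda> G" "b \<in> gp_words \<Lambda> G" "(a @ b, []) \<in> R" "(b @ a, []) \<in> R"
    "(v, a @ w @ b) \<in> R" "(w, b @ v @ a) \<in> R"
    using conjugate_words[OF conj gen_words_closed[OF v] gen_words_closed[OF w]] by metis
  have "n * length (vertex_letters i w) \<le> n * length (vertex_letters i v) + (cost i a + cost i b)"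
    for n
  proof -
    let ?w = "concat (replicate n w)" and ?v = "b @ concat (replicate n v) @ a"
    have rel: "(?w, ?v) \<in> R" using ab by (intro gp_rel_conjugate_power)
    have "n * length (vertex_letters i w) = length (vertex_letters i ?w)"
      by (induction n) auto
    also have "\<dots> = weight i (act i ?w [])"
      using weight_act[OF i(1)] periodic_locally_geodesic[OF cyc i(1) True i(2)] by simp
    also have "\<dots> = weight i (act i ?v [])"
      using act_rel[OF i(1) rel reduced_Nil[OF i(1)]] by simp
    also have "\<dots> \<le> cost i ?v"
      using weight_act_le[OF i(1) gp_rel_words(2)[OF rel] reduced_Nil[OF i(1)]] i(1) by simp
    also have "\<dots> = cost i b + n * cost i v + cost i a"
      using i(1) by (simp add: cost_append cost_power)
    also have "\<dots> \<le> n * length (vertex_letters i v) + (cost i a + cost i b)"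
      using cost_gen_words[OF i(1) v] by simp
    finally show ?thesis .
  qed
  then show ?thesis by (rule le_if_multiples_le)
qed

text \<open>Every rotation of \<open>w\<close> is a geodesic star word, so the
  \<open>i\<close>-letters of \<open>w\<close> form a cyclically geodesic word. The retraction to
  \<open>G i\<close> preserves conjugacy, and the hypothesis on \<open>G i\<close> compares the
  counts.\<close>

lemma vertex_count_isolated:
  assumes cyc: "\<And>n. geo_word (rotate n w)" and v: "v \<in> gen_words"
    and conj: "conjugate P (cls w) (cls v)"
    and i: "i \<in> pverts \<Lambda>" "fst ` set w \<subseteq> insert i (link i)"
    and CycGeo: "CycGeo (G i) (X i) \<subseteq> ConjGeo (G i) (X i)"
  shows "length (vertex_letters i w) \<le> length (vertex_letters i v)"
proof -
  interpret Gi: finitely_generated "G i" "X i" using i(1) by (rule finitely_generated_vertex)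
  have w: "w \<in> gen_words" using cyc[of 0] by (simp add: geo_word_def)
  have "geodesic (G i) (X i) (rotate n (vertex_letters i w))" for n
  proof -
    obtain m where "rotate n (vertex_letters i w) = vertex_letters i (rotate m w)"
      using rotate_filter[of n _ w] unfolding vertex_letters_def rotate_map by metis
    then show ?thesis using geo_word_star[OF i(1) cyc] i(2) by simp
  qed
  then have "vertex_letters i w \<in> ConjGeo (G i) (X i)"
    using CycGeo vertex_letters_gen[OF w] by (auto simp: CycGeo_def)
  moreover have "conjugate (G i) (vertex_value i w) (vertex_value i v)"
  proof -
    obtain a b where ab: "a \<in> gp_words \<Lambda> G" "b \<in> gp_words \<Lambda> G" "(a @ b, []) \<in> R"
      "(v, a @ w @ b) \<in> R"
      using conjugate_words[OF conj gen_words_closed[OF v] gen_words_closed[OF w]] by metis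
    have closed: "vertex_value i a \<in> carrier (G i)" "vertex_value i b \<in> carrier (G i)"
        "vertex_value i w \<in> carrier (G i)"
      using ab i(1) gen_words_closed[OF w] by simp_all
    have "vertex_value i a \<otimes>\<^bsub>G i\<^esub> vertex_value i b = \<one>\<^bsub>G i\<^esub>"
      using vertex_value_rel[OF i(1) ab(3)] ab i(1) by (simp add: vertex_value_append)
    then have "vertex_value i b = inv\<^bsub>G i\<^esub> vertex_value i a"
      using closed Gi.inv_equality Gi.inv_inv by metis
    moreover have "vertex_value i v =
        vertex_value i a \<otimes>\<^bsub>G i\<^esub> vertex_value i w \<otimes>\<^bsub>G i\<^esub> vertex_value i b"
      using vertex_value_rel[OF i(1) ab(4)] ab i(1) gen_words_closed[OF w] closed
      by (simp add: vertex_value_append Gi.m_assoc)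
    ultimately show ?thesis using closed unfolding conjugate_def by metis
  qed
  ultimately show ?thesis
    using vertex_letters_gen[OF v] unfolding Gi.ConjGeo_iff vertex_value_def by blast
qed

theorem CycGeo_subset_ConjGeo:
  assumes "\<And>i. i \<in> pverts \<Lambda> \<Longrightarrow> CycGeo (G i) (X i) \<subseteq> ConjGeo (G i) (X i)"
  shows "CycGeo P (gp_generators \<Lambda> G X) \<subseteq> ConjGeo P (gp_generators \<Lambda> G X)"
proof
  let ?f = "map (case_prod (gp_incl \<Lambda> G))"
  fix y assume y: "y \<in> CycGeo P (gp_generators \<Lambda> G X)"
  then obtain w where w: "w \<in> gen_words" "y = ?f w"
    unfolding CycGeo_def gen_words_image by blast
  have cyc: "geo_word (rotate n w)" for n
  proof -
    have "rotate n w \<in> gen_words" using w(1) by (simp add: in_lists_conv_set)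
    then show ?thesis
      using y geodesic_iff_geo_word[of "rotate n w"] by (simp add: CycGeo_def w(2) rotate_map)
  qed
  have "length w \<le> length v" if v: "v \<in> gen_words" "conjugate P (cls w) (cls v)" for v
  proof -
    have "length (vertex_letters i w) \<le> length (vertex_letters i v)" if i: "i \<in> pverts \<Lambda>" for i
      using vertex_count_isolated[OF cyc v i _ assms[OF i]] vertex_count_nonisolated[OF cyc v i]
      by blast
    then show ?thesis
      unfolding length_eq_sum_vertex_letters[OF w(1)] length_eq_sum_vertex_letters[OF v(1)]
      by (rule sum_mono)
  qed
  then show "y \<in> ConjGeo P (gp_generators \<Lambda> G X)"
    using w unfolding P.ConjGeo_iff gen_words_image by (auto simp: gen_words_value)
qed

end

theorem theorem2p4:
  fixes \<Lambda> :: "'v pair_pre_digraph"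
    and G :: "'v \<Rightarrow> ('a, 'b) monoid_scheme"
    and X :: "'v \<Rightarrow> 'a set"
  assumes "pair_graph \<Lambda>"
    and "\<And>i. i \<in> pverts \<Lambda> \<Longrightarrow> group (G i)"
    and "\<And>i. i \<in> pverts \<Lambda> \<Longrightarrow> fin_inv_closed_generators (G i) (X i)"
    and "\<And>i. i \<in> pverts \<Lambda> \<Longrightarrow> CycGeo (G i) (X i) = ConjGeo (G i) (X i)"
  shows "CycGeo (graph_product \<Lambda> G) (gp_generators \<Lambda> G X) =
         ConjGeo (graph_product \<Lambda> G) (gp_generators \<Lambda> G X)"
proof -
  interpret generated_graph_product \<Lambda> G X
    using assms(1-3)
    by (intro generated_graph_product.intro graph_of_groups.intro graph_of_groups_axioms.intro
        generated_graph_product_axioms.intro)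
  show ?thesis using CycGeo_subset_ConjGeo assms(4) P.ConjGeo_subset_CycGeo by blast
qed

end
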